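(* Let $1<p<2$ and $p^*=p/(p-1)$. Then $$ r_{p,p^*}(\mathbb{Z}_3)=\frac{2(4^{1/p^*}-1)}{4-4^{1/p^*}} \quad\text{and}\quad r_{p,2}(\mathbb{Z}_3)=r_{2,p^*}(\mathbb{Z}_3)=\sqrt{\frac{2(4^{1/p^*}-1)}{4-4^{1/p^*}}}. $$ Consequently, $r_{p,p^*}(\mathbb{Z}_3)=r_{p,2}(\mathbb{Z}_3)\,r_{2,p^*}(\mathbb{Z}_3)$.
   Context: Let $\mathbb{Z}_3=\mathbb{Z}/3\mathbb{Z}$ be equipped with the uniform probability measure, and let $L^p(\mathbb{Z}_3)$ be the space of complex-valued functions on $\mathbb{Z}_3$ with $\|f\|_p=\big(\frac13\sum_{k\in\mathbb{Z}_3}|f(k)|^p\big)^{1/p}$. Let $\chi$ be the character of $\mathbb{Z}_3$ with $\chi(1)=e^{2\pi i/3}$, so that every function is uniquely $f=a_0+a_1\chi+a_2\overline{\chi}$ with $a_0,a_1,a_2\in\mathbb{C}$. For $r\in[0,1]$ define $T_r(a_0+a_1\chi+a_2\overline{\chi})=a_0+ra_1\chi+ra_2\overline{\chi}$. For $1<p<q<\infty$, $r_{p,q}(\mathbb{Z}_3)\in[0,1]$ is the largest constant such that $\|T_rf\|_q\le\|f\|_p$ for all $0\le r\le r_{p,q}(\mathbb{Z}_3)$ and all $f\in L^p(\mathbb{Z}_3)$. *)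

theory Defs
  imports "HOL-Analysis.Analysis"
begin

text \<open>
  The group of integers modulo 3 is the numeral type \<open>3\<close>, in which \<open>3 = 0\<close>; functions on it
  are \<open>3 \<Rightarrow> complex\<close>.
\<close>

definition Lp_norm :: "real \<Rightarrow> (3 \<Rightarrow> complex) \<Rightarrow> real" where
  "Lp_norm p f = ((1/3) * (\<Sum>k\<in>UNIV. norm (f k) powr p)) powr (1/p)"

definition chi :: "3 \<Rightarrow> complex" where
  "chi k = (if k = 0 then 1 else if k = 1 then cis (2*pi/3) else cis (2*pi/3) ^ 2)"

definition trig :: "complex \<Rightarrow> complex \<Rightarrow> complex \<Rightarrow> 3 \<Rightarrow> complex" where
  "trig a0 a1 a2 = (\<lambda>k. a0 + a1 * chi k + a2 * cnj (chi k))"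

text \<open>The description is justified by \<open>trig_exists\<close> and \<open>trig_inject\<close> below.\<close>

definition T :: "real \<Rightarrow> (3 \<Rightarrow> complex) \<Rightarrow> (3 \<Rightarrow> complex)" where
  "T r f = (THE g. \<exists>a0 a1 a2. f = trig a0 a1 a2 \<and>
                               g = trig a0 (of_real r * a1) (of_real r * a2))"

definition admissible :: "real \<Rightarrow> real \<Rightarrow> real \<Rightarrow> bool" where
  "admissible p q s \<longleftrightarrow> s \<in> {0..1} \<and> (\<forall>r\<in>{0..s}. \<forall>f. Lp_norm q (T r f) \<le> Lp_norm p f)"

text \<open>The greatest admissible constant exists for \<open>1 \<le> p\<close> and \<open>0 < q\<close>, see \<open>r_const_greatest\<close>.\<close>

definition r_const :: "real \<Rightarrow> real \<Rightarrow> real" where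
  "r_const p q = (GREATEST s. admissible p q s)"

lemma cis_third: "cis (2*pi/3) = Complex (-1/2) (sqrt 3 / 2)"
  by (simp add: complex_eq_iff cos_120 sin_120)

lemma cis_third_square: "cis (2*pi/3) ^ 2 = Complex (-1/2) (- (sqrt 3 / 2))"
  unfolding cis_third by (simp add: complex_eq_iff power2_eq_square)

lemma three_eq_zero: "(3::3) = 0"
  by simp

lemma two_neq: "(2::3) \<noteq> 0" "(2::3) \<noteq> 1" "(1::3) \<noteq> 2"
  by simp_all

lemma chi_values:
  "chi 0 = 1"
  "chi 1 = Complex (-1/2) (sqrt 3 / 2)"
  "chi 2 = Complex (-1/2) (- (sqrt 3 / 2))"
  by (simp_all add: chi_def cis_third_square) (simp add: cis_third)

lemma chi_1: "chi 1 = exp (2 * of_real pi * \<i> / 3)"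
proof -
  have "chi 1 = cis (2*pi/3)" by (simp add: chi_def)
  then show ?thesis by (simp add: cis_conv_exp mult_ac)
qed

lemma all_Z3: "(\<forall>k::3. P k) \<longleftrightarrow> P 0 \<and> P 1 \<and> P 2"
  using forall_3[of P] three_eq_zero by auto

lemma sum_Z3: "(\<Sum>k\<in>(UNIV::3 set). f k) = f 0 + f 1 + (f 2 :: 'a::comm_monoid_add)"
  using sum_3[of f] three_eq_zero by (simp add: ac_simps)

lemma chi_add: "chi (j + k) = chi j * chi k"
proof -
  have s: "(1::3) + 1 = 2" "(1::3) + 2 = 0" "(2::3) + 1 = 0" "(2::3) + 2 = 1" by simp_all
  have "\<forall>j k. chi (j + k) = chi j * chi k"
    unfolding all_Z3 s add_0_left add_0_right chi_values
    by (simp add: complex_eq_iff)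
  then show ?thesis by blast
qed

lemma chi_roots: "1 + chi 1 + chi 2 = 0" "cnj (chi 1) = chi 2" "cnj (chi 2) = chi 1"
    "chi 1 * chi 2 = 1" "chi 1 * chi 1 = chi 2" "chi 2 * chi 2 = chi 1"
  by (simp_all add: chi_values complex_eq_iff)

lemma trig_values:
  "trig a b c 0 = a + b + c"
  "trig a b c 1 = a + b * chi 1 + c * chi 2"
  "trig a b c 2 = a + b * chi 2 + c * chi 1"
  by (simp_all add: trig_def chi_roots) (simp_all add: chi_values)

lemma trig_coeffs:
  "3 * a = trig a b c 0 + trig a b c 1 + trig a b c 2"
  "3 * b = trig a b c 0 + trig a b c 1 * chi 2 + trig a b c 2 * chi 1"
  "3 * c = trig a b c 0 + trig a b c 1 * chi 1 + trig a b c 2 * chi 2"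
proof -
  have w: "chi 2 = - 1 - chi 1" "chi 1 * chi 1 = - 1 - chi 1"
    by (simp_all add: chi_values complex_eq_iff)
  have w': "chi 1 * (chi 1 * x) = (- 1 - chi 1) * x" for x
    using w(2) by (metis mult.assoc)
  show "3 * a = trig a b c 0 + trig a b c 1 + trig a b c 2"
    "3 * b = trig a b c 0 + trig a b c 1 * chi 2 + trig a b c 2 * chi 1"
    "3 * c = trig a b c 0 + trig a b c 1 * chi 1 + trig a b c 2 * chi 2"
    unfolding trig_values w(1) by (simp_all add: algebra_simps w(2) w')
qed

lemma trig_inject: "trig a b c = trig a' b' c' \<longleftrightarrow> a = a' \<and> b = b' \<and> c = c'"
proof
  assume eq: "trig a b c = trig a' b' c'"
  have "3 * a = 3 * a'" "3 * b = 3 * b'" "3 * c = 3 * c'"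
    unfolding trig_coeffs(1)[of a b c] trig_coeffs(1)[of a' b' c']
      trig_coeffs(2)[of b a c] trig_coeffs(2)[of b' a' c']
      trig_coeffs(3)[of c a b] trig_coeffs(3)[of c' a' b'] eq
    by (rule refl)+
  then show "a = a' \<and> b = b' \<and> c = c'" by simp
qed simp

lemma trig_exists: "\<exists>a0 a1 a2. f = trig a0 a1 a2"
proof -
  define a where "a = (f 0 + f 1 + f 2) / 3"
  define b where "b = (f 0 + f 1 * chi 2 + f 2 * chi 1) / 3"
  define c where "c = (f 0 + f 1 * chi 1 + f 2 * chi 2) / 3"
  have w: "chi 2 = - 1 - chi 1" "chi 1 * chi 1 = - 1 - chi 1"
    by (simp_all add: chi_values complex_eq_iff)
  have w': "chi 1 * (chi 1 * x) = (- 1 - chi 1) * x" for x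
    using w(2) by (metis mult.assoc)
  have "f 0 = trig a b c 0" "f 1 = trig a b c 1" "f 2 = trig a b c 2"
    unfolding trig_values a_def b_def c_def w(1) by (simp_all add: field_simps w(2) w')
  then have "f k = trig a b c k" for k using all_Z3[of "\<lambda>k. f k = trig a b c k"] by blast
  then show ?thesis by blast
qed

lemma T_trig: "T r (trig a0 a1 a2) = trig a0 (of_real r * a1) (of_real r * a2)"
  unfolding T_def by (rule the_equality) (auto simp: trig_inject)

lemma powr_above_tangent:
  fixes p x m :: real
  assumes "1 \<le> p" "0 \<le> x" "0 < m"
  shows "m powr p + p * m powr (p - 1) * (x - m) \<le> x powr p"
proof (cases "x = 0")
  case True
  have "m powr p = m powr (p - 1) * m"
    using assms by (simp add: powr_mult_base mult.commute)
  then have "m powr p + p * m powr (p - 1) * (x - m) = (1 - p) * m powr p"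
    by (simp add: True algebra_simps)
  also have "\<dots> \<le> 0" using assms by (simp add: mult_nonpos_nonneg)
  finally show ?thesis by (simp add: True)
next
  case False
  have "p * m powr (p - 1) * (x - m) \<le> x powr p - m powr p"
  proof (rule convex_on_imp_above_tangent[OF powr_convex[OF assms(1)]])
    show "connected {0::real<..}" by simp
    show "m \<in> interior {0<..}" using assms by (simp add: interior_open)
    show "x \<in> {0<..}" using False assms by simp
    show "((\<lambda>x. x powr p) has_real_derivative p * m powr (p - 1)) (at m within {0<..})"
      using assms by (auto intro!: derivative_eq_intros)
  qed
  then show ?thesis by simp
qed

lemma norm_mean_le:
  assumes "1 \<le> p"
  shows "norm a0 \<le> Lp_norm p (trig a0 a1 a2)"
proof -
  define f where "f = trig a0 a1 a2"
  define m where "m = (norm (f 0) + norm (f 1) + norm (f 2)) / 3"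
  define S where "S = (1/3) * (\<Sum>k\<in>UNIV. norm (f k) powr p)"
  have "3 * norm a0 = norm (f 0 + f 1 + f 2)"
    unfolding f_def trig_coeffs(1)[symmetric] by (simp add: norm_mult)
  also have "\<dots> \<le> 3 * m"
    unfolding m_def using norm_triangle_ineq[of "f 0 + f 1" "f 2"] norm_triangle_ineq[of "f 0" "f 1"]
    by simp
  finally have am: "norm a0 \<le> m" by simp
  have "m \<ge> 0" by (simp add: m_def)
  have "m powr p \<le> S"
  proof (cases "m = 0")
    case True
    then show ?thesis by (simp add: S_def sum_nonneg)
  next
    case False
    then have m: "m > 0" using \<open>m \<ge> 0\<close> by simp
    let ?d = "p * m powr (p - 1)"
    have t: "m powr p + ?d * (norm (f k) - m) \<le> norm (f k) powr p" for k
      by (rule powr_above_tangent) (use assms m in auto)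
    have "?d * (norm (f 0) - m) + ?d * (norm (f 1) - m) + ?d * (norm (f 2) - m)
          = ?d * (norm (f 0) + norm (f 1) + norm (f 2) - 3 * m)"
      by (simp add: algebra_simps)
    also have "\<dots> = 0" by (simp add: m_def)
    finally show ?thesis unfolding S_def sum_Z3 using t[of 0] t[of 1] t[of 2] by simp
  qed
  then have "(m powr p) powr (1/p) \<le> S powr (1/p)"
    using assms by (intro powr_mono2) auto
  moreover have "(m powr p) powr (1/p) = m" using assms \<open>m \<ge> 0\<close> by (simp add: powr_powr)
  ultimately show ?thesis using am unfolding Lp_norm_def S_def f_def by simp
qed

lemma admissible_0:
  assumes "1 \<le> p" "0 < q"
  shows "admissible p q 0"
  unfolding admissible_def
proof (intro conjI ballI allI)
  fix r :: real and f assume "r \<in> {0..0}"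
  then have r: "r = 0" by simp
  obtain a0 a1 a2 where f: "f = trig a0 a1 a2" using trig_exists by blast
  have "Lp_norm q (T r f) = norm a0"
    unfolding f T_trig r using assms by (simp add: trig_def Lp_norm_def powr_powr)
  then show "Lp_norm q (T r f) \<le> Lp_norm p f"
    using norm_mean_le[OF assms(1)] f by simp
qed simp

lemma continuous_on_Lp_norm_T:
  assumes "0 < q"
  shows "continuous_on UNIV (\<lambda>r. Lp_norm q (T r f))"
proof -
  obtain a0 a1 a2 where f: "f = trig a0 a1 a2" using trig_exists by blast
  show ?thesis
    unfolding f T_trig unfolding Lp_norm_def trig_def using assms
    by (intro continuous_on_powr' continuous_intros ballI) (auto simp: sum_nonneg)
qed

lemma r_const_greatest:
  assumes "1 \<le> p" "0 < q"
  shows "admissible p q (r_const p q)" and "admissible p q s \<Longrightarrow> s \<le> r_const p q"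
proof -
  let ?A = "{s. admissible p q s}"
  define m where "m = Sup ?A"
  have bdd: "bdd_above ?A" by (rule bdd_aboveI[of _ 1]) (auto simp: admissible_def)
  have zero: "0 \<in> ?A" using admissible_0[OF assms] by simp
  have up: "s \<le> m" if "admissible p q s" for s
    unfolding m_def using bdd that by (intro cSup_upper) auto
  have m: "0 \<le> m" using up zero by simp
  have "m \<le> 1" unfolding m_def using zero by (intro cSup_least) (blast, simp add: admissible_def)
  have below: "Lp_norm q (T r f) \<le> Lp_norm p f" if r0: "0 \<le> r" and rm: "r < m" for r f
  proof -
    obtain s where "s \<in> ?A" "r < s"
      using rm less_cSup_iff[OF _ bdd] zero unfolding m_def by blast
    then show ?thesis using r0 by (auto simp: admissible_def)
  qed
  have "Lp_norm q (T r f) \<le> Lp_norm p f" if "r \<in> {0..m}" for r f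
  proof (cases "m = 0")
    case True
    then show ?thesis using that zero by (auto simp: admissible_def)
  next
    case False
    let ?C = "{r. Lp_norm q (T r f) \<le> Lp_norm p f}"
    have "closed ?C"
      using continuous_on_Lp_norm_T[OF assms(2)] by (intro closed_Collect_le continuous_intros)
    moreover have "{0..<m} \<subseteq> ?C" using below by auto
    ultimately have "closure {0..<m} \<subseteq> ?C" by (rule closure_minimal[rotated])
    moreover have "closure {0..<m} = {0..m}"
      using False m by (intro closure_atLeastLessThan) simp
    ultimately show ?thesis using that by auto
  qed
  then have adm: "admissible p q m" using m \<open>m \<le> 1\<close> by (simp add: admissible_def)
  have "r_const p q = m"
    unfolding r_const_def using adm up by (rule Greatest_equality)
  then show "admissible p q (r_const p q)" "admissible p q s \<Longrightarrow> s \<le> r_const p q"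
    using adm up by auto
qed

end

theory Submission
  imports Defs
begin

text \<open>
  Everything reduces to \<open>\<parallel>T r f\<parallel>\<^sub>2 \<le> \<parallel>f\<parallel>\<^sub>p\<close>. As \<open>T r\<close> is self-adjoint, this bound is dual to
  \<open>\<parallel>T r f\<parallel> \<le> \<parallel>f\<parallel>\<^sub>2\<close> with the exponent \<open>p*\<close> on the left, and as \<open>T r (T r f) = T (r\<^sup>2) f\<close>,
  the norm of \<open>T (r\<^sup>2)\<close> from exponent \<open>p\<close> to \<open>p*\<close> is the square of the norm of \<open>T r\<close> from \<open>p\<close>
  to \<open>2\<close>.

  With \<open>\<rho> = r\<^sup>2\<close>, \<open>\<parallel>T r f\<parallel>\<^sub>2\<^sup>2 = (1 - \<rho>) |E f|\<^sup>2 + \<rho> E |f|\<^sup>2\<close>, so \<open>f\<close> may be assumed nonnegative.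
  A maximizer of \<open>\<parallel>T r f\<parallel>\<^sub>2 / \<parallel>f\<parallel>\<^sub>p\<close> satisfies \<open>(1 - \<rho>) E f + \<rho> f k = \<lambda> (f k) powr (p - 1)\<close> for
  every \<open>k\<close>; an affine and a strictly concave function meet in at most two points, so \<open>f\<close> takes
  at most two values. The remaining inequality in one variable becomes, in hyperbolic
  coordinates, the monotonicity of \<open>sinh (\<theta> w) / sinh w\<close> for \<open>0 \<le> \<theta> \<le> 1\<close>.
\<close>

section \<open>The two-valued inequality\<close>

text \<open>The quotient has derivative \<open>- D w / (sinh w)\<^sup>2\<close>. Here
  \<open>D\<close> vanishes at 0 and has derivative
  \<open>(1 - \<theta>\<^sup>2) * (sinh (\<theta> * u) * sinh u)\<close>, which is nonnegative for
  \<open>0 \<le> u\<close>.\<close>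

lemma sinh_scaled_ratio_antimono:
  fixes \<theta> a b :: real
  assumes "0 \<le> \<theta>" "\<theta> \<le> 1" "0 < a" "a \<le> b"
  shows "sinh (\<theta> * b) / sinh b \<le> sinh (\<theta> * a) / sinh a"
proof -
  define D where "D w = sinh (\<theta> * w) * cosh w - \<theta> * cosh (\<theta> * w) * sinh w" for w :: real
  have D_nonneg: "0 \<le> D w" if "0 \<le> w" for w
  proof -
    have "D 0 \<le> D w"
    proof (rule DERIV_nonneg_imp_nondecreasing[OF that])
      fix u :: real assume "0 \<le> u"
      have "(D has_real_derivative (1 - \<theta>\<^sup>2) * (sinh (\<theta> * u) * sinh u)) (at u)"
        unfolding D_def
        by (auto intro!: derivative_eq_intros simp: algebra_simps power2_eq_square)
      moreover have "0 \<le> (1 - \<theta>\<^sup>2) * (sinh (\<theta> * u) * sinh u)"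
        using assms \<open>0 \<le> u\<close> by (simp add: power_le_one)
      ultimately show "\<exists>y. DERIV D u :> y \<and> 0 \<le> y" by blast
    qed
    then show ?thesis by (simp add: D_def)
  qed
  show ?thesis
  proof (rule DERIV_nonpos_imp_nonincreasing[OF assms(4)])
    fix w assume "a \<le> w"
    then have w: "0 < w" using assms by simp
    have "((\<lambda>w. sinh (\<theta> * w) / sinh w) has_real_derivative - D w / (sinh w)\<^sup>2) (at w)"
      unfolding D_def using w
      by (auto intro!: derivative_eq_intros simp: algebra_simps power2_eq_square)
    moreover have "- D w / (sinh w)\<^sup>2 \<le> 0" using D_nonneg[of w] w by simp
    ultimately show "\<exists>y. DERIV (\<lambda>w. sinh (\<theta> * w) / sinh w) w :> y \<and> y \<le> 0" by blast
  qed
qed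

lemma powr_double: "0 < x \<Longrightarrow> x powr (2 * s) = (x\<^sup>2) powr s" for x s :: real
  using powr_powr[of x 2 s] by simp

text \<open>Equality holds at \<open>v = ln 2\<close>: the sign of the logarithmic derivative of the quotient of the
  two sides is that of \<open>N\<close>, which changes from plus to minus there.\<close>

lemma two_valued_cosh:
  fixes s v :: real
  assumes s: "1/2 < s" "s < 1" and v: "0 \<le> v"
  defines "b \<equiv> 2 powr s"
  shows "2 * b * cosh (s * v) + (2 * b\<^sup>2 - 4)
           \<le> 3 * (b\<^sup>2 - 1) * ((8/9) powr s * cosh (v/2) powr (2 * s))"
proof -
  define c where "c = 2 * b\<^sup>2 - 4"
  define L where "L = ln (2::real)"
  have L: "0 < L" by (simp add: L_def)
  have b2: "b\<^sup>2 = 4 powr s"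
    unfolding b_def power2_eq_square by (simp flip: powr_mult)
  have "(4::real) powr (1/2) < 4 powr s" using s by (intro powr_less_mono) auto
  then have c: "0 < c" by (simp add: c_def b2 powr_half_sqrt)
  have b: "0 < b" by (simp add: b_def)
  define A where "A u = 2 * b * cosh (s * u) + c" for u
  have A_pos: "0 < A u" for u using b c by (simp add: A_def add_pos_pos)
  define H where "H u = ln (A u) - 2 * s * ln (cosh (u/2))" for u
  define N where "N u = 2 * b * sinh ((s - 1/2) * u) - c * sinh (u/2)" for u
  have dH: "(H has_real_derivative s * N u / (A u * cosh (u/2))) (at u)" for u
  proof -
    have h: "sinh ((s - 1/2) * u) = sinh (s * u) * cosh (u/2) - cosh (s * u) * sinh (u/2)"
      by (simp add: left_diff_distrib sinh_diff)
    have N: "N u = 2 * b * sinh (s * u) * cosh (u/2) - A u * sinh (u/2)"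
      unfolding N_def A_def h by (simp add: algebra_simps)
    have *: "s * N u / (A u * cosh (u/2))
        = 2 * b * (s * sinh (s * u)) / A u - 2 * s * (sinh (u/2) / 2 / cosh (u/2))"
      unfolding N using A_pos[of u] by (simp add: field_simps)
    show ?thesis unfolding * unfolding H_def A_def
      using A_pos[of u, unfolded A_def] by (auto intro!: derivative_eq_intros simp: field_simps)
  qed
  \<comment> \<open>Dividing \<open>N u\<close> by \<open>sinh (u/2)\<close> leaves
    \<open>2 * b * R (u/2) - c\<close>, which decreases in \<open>u\<close>. So the zero at
    \<open>L\<close> alone determines the sign of \<open>N\<close> on each side of
    \<open>L\<close>.\<close>
  define R where "R w = sinh ((2 * s - 1) * w) / sinh w" for w :: real
  have b_split: "b = 2 powr (1/2) * 2 powr (s - 1/2)"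
    unfolding b_def by (simp flip: powr_add)
  \<comment> \<open>With \<open>b = sqrt 2 * k\<close>, both terms of \<open>N L\<close> equal
    \<open>sqrt 2 * (k\<^sup>2 - 1)\<close>.\<close>
  have NL: "N L = 0"
  proof -
    define k where "k = (2::real) powr (s - 1/2)"
    have k: "0 < k" by (simp add: k_def)
    have e1: "sinh ((s - 1/2) * L) = (k - 1/k) / 2"
      unfolding L_def k_def by (simp add: sinh_field_def powr_def exp_minus field_simps)
    have e2: "sinh (L/2) = (sqrt 2 - 1 / sqrt 2) / 2"
    proof -
      have "L/2 = ln (sqrt 2)" by (simp add: L_def ln_sqrt)
      then show ?thesis by (simp add: sinh_ln_real inverse_eq_divide)
    qed
    have bk: "b = sqrt 2 * k" using b_split by (simp add: k_def powr_half_sqrt)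
    show ?thesis unfolding N_def e1 e2 c_def bk using k
      by (simp add: field_simps power2_eq_square)
  qed
  have N_R: "N u = (2 * b * R (u/2) - c) * sinh (u/2)" if "0 < u" for u
    using that by (simp add: N_def R_def field_simps)
  have RL: "2 * b * R (L/2) = c" using N_R[OF L] NL L by simp
  have R_mono: "R w' \<le> R w" if "0 < w" "w \<le> w'" for w w'
    unfolding R_def using sinh_scaled_ratio_antimono[of "2 * s - 1" w w'] s that by simp
  have N_nonneg: "0 \<le> N u" if "0 \<le> u" "u \<le> L" for u
  proof (cases "u = 0")
    case False
    then have "2 * b * R (L/2) \<le> 2 * b * R (u/2)" using R_mono[of "u/2" "L/2"] that b by simp
    then show ?thesis using N_R[of u] RL that False by simp
  qed (simp add: N_def)
  have N_nonpos: "N u \<le> 0" if "L \<le> u" for u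
  proof -
    have "2 * b * R (u/2) \<le> 2 * b * R (L/2)" using R_mono[of "L/2" "u/2"] that b L by simp
    then show ?thesis using N_R[of u] RL that L by (simp add: mult_nonpos_nonneg)
  qed
  have HL: "H v \<le> H L"
  proof (cases "v \<le> L")
    case True
    then show ?thesis
    proof (rule DERIV_nonneg_imp_nondecreasing)
      fix u assume "v \<le> u" "u \<le> L"
      then have "0 \<le> s * N u / (A u * cosh (u/2))"
        using N_nonneg[of u] v s A_pos[of u] by simp
      then show "\<exists>y. DERIV H u :> y \<and> 0 \<le> y" using dH by blast
    qed
  next
    case False
    then have "L \<le> v" by simp
    then show ?thesis
    proof (rule DERIV_nonpos_imp_nonincreasing)
      fix u assume "L \<le> u"
      then have "s * N u / (A u * cosh (u/2)) \<le> 0"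
        using N_nonpos[of u] s A_pos[of u]
        by (intro divide_nonpos_nonneg mult_nonneg_nonpos) (auto simp: less_imp_le)
      then show "\<exists>y. DERIV H u :> y \<and> y \<le> 0" using dH by blast
    qed
  qed
  \<comment> \<open>Exponentiating \<open>H v \<le> H L\<close> gives the claim; its constants are
    \<open>A L\<close> and \<open>(cosh (L/2))\<^sup>2 = 9/8\<close>.\<close>
  have eH: "exp (H u) = A u / cosh (u/2) powr (2 * s)" for u
    using A_pos[of u] by (simp add: H_def exp_diff powr_def)
  have cL: "cosh (L/2) powr (2 * s) = (9/8) powr s"
  proof -
    have "cosh (L/2) = (sqrt 2 + 1 / sqrt 2) / 2"
    proof -
      have "L/2 = ln (sqrt 2)" by (simp add: L_def ln_sqrt)
      then show ?thesis by (simp add: cosh_ln_real inverse_eq_divide)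
    qed
    then have "cosh (L/2) = 3 / (2 * sqrt 2)" by (simp add: field_simps)
    then have "(cosh (L/2))\<^sup>2 = 9/8" by (simp add: power_divide power_mult_distrib)
    then show ?thesis by (simp only: powr_double[OF cosh_real_pos])
  qed
  have AL: "A L = 3 * (b\<^sup>2 - 1)"
  proof -
    have "cosh (s * L) = (b + 1/b) / 2"
      unfolding L_def b_def by (simp add: cosh_field_def powr_def exp_minus field_simps)
    then show ?thesis using b by (simp add: A_def c_def field_simps power2_eq_square)
  qed
  have "A v / cosh (v/2) powr (2 * s) \<le> 3 * (b\<^sup>2 - 1) / (9/8) powr s"
    using HL eH[of v] eH[of L] AL cL by (metis exp_le_cancel_iff)
  then have "A v \<le> 3 * (b\<^sup>2 - 1) / (9/8) powr s * cosh (v/2) powr (2 * s)"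
    by (simp add: divide_le_eq)
  moreover have "(8/9::real) powr s = 1 / (9/8) powr s"
    by (simp add: powr_divide)
  ultimately show ?thesis unfolding A_def c_def by simp
qed


text \<open>Both sides are multiplied by \<open>c / t\<^sup>2\<^sup>s\<close> under \<open>t \<mapsto> 4/t\<close>, which suggests \<open>t = 2 exp v\<close>.\<close>

lemma two_valued_powr:
  fixes s t :: real
  assumes s: "1/2 < s" "s < 1" and t: "0 < t"
  defines "c \<equiv> 4 powr s"
  shows "(t powr s)\<^sup>2 + (2 * c - 4) * t powr s + c \<le> 3 * (c - 1) * ((t + 2) / 3) powr (2 * s)"
proof -
  define v where "v = ln (t/2)"
  define b where "b = (2::real) powr s"
  have t_v: "t = 2 * exp v" using t by (simp add: v_def)
  have b: "0 < b" by (simp add: b_def)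
  have b2: "b\<^sup>2 = c"
    unfolding b_def c_def power2_eq_square by (simp flip: powr_mult)
  have x: "t powr s = b * exp (s * v)"
    unfolding t_v b_def by (simp add: powr_mult exp_powr_real mult.commute)
  have abs_v: "cosh (s * \<bar>v\<bar>) = cosh (s * v)" "cosh (\<bar>v\<bar> / 2) = cosh (v/2)"
    by (simp_all add: abs_if)
  have "2 * b * cosh (s * v) + (2 * c - 4)
      \<le> 3 * (c - 1) * ((8/9) powr s * cosh (v/2) powr (2 * s))"
    using two_valued_cosh[OF s, of "\<bar>v\<bar>"] unfolding b_def[symmetric] b2 abs_v by simp
  then have "t powr s * (2 * b * cosh (s * v) + (2 * c - 4))
      \<le> t powr s * (3 * (c - 1) * ((8/9) powr s * cosh (v/2) powr (2 * s)))"
    by (intro mult_left_mono) auto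
  moreover have "t powr s * (2 * b * cosh (s * v)) = (t powr s)\<^sup>2 + c"
  proof -
    have "2 * cosh (s * v) = exp (s * v) + 1 / exp (s * v)"
      by (simp add: cosh_field_def exp_minus field_simps)
    then show ?thesis unfolding x b2[symmetric] using b
      by (simp add: power2_eq_square field_simps)
  qed
  moreover have "t powr s * ((8/9) powr s * cosh (v/2) powr (2 * s)) = ((t + 2) / 3) powr (2 * s)"
  proof -
    have "cosh (v/2) powr (2 * s) = ((cosh (v/2))\<^sup>2) powr s"
      by (simp only: powr_double[OF cosh_real_pos])
    then have "t powr s * ((8/9) powr s * cosh (v/2) powr (2 * s))
        = (t * ((8/9) * (cosh (v/2))\<^sup>2)) powr s"
      by (simp only: powr_mult)
    also have "t * ((8/9) * (cosh (v/2))\<^sup>2) = ((t + 2) / 3)\<^sup>2"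
    proof -
      have e: "exp v = exp (v/2) * exp (v/2)" by (simp flip: exp_add)
      show ?thesis unfolding t_v e
        by (simp add: cosh_field_def exp_minus power2_eq_square field_simps)
    qed
    also have "(((t + 2) / 3)\<^sup>2) powr s = ((t + 2) / 3) powr (2 * s)"
      using t by (simp add: powr_double)
    finally show ?thesis .
  qed
  ultimately show ?thesis by (simp add: algebra_simps)
qed

section \<open>From two values to three\<close>

text \<open>For the function with real values \<open>x\<close>, \<open>y\<close>, \<open>z\<close>
  this is the square of the 2-norm of its image under \<open>T r\<close>, where
  \<open>\<rho> = r\<^sup>2\<close>.\<close>

definition quad_mean :: "real \<Rightarrow> real \<Rightarrow> real \<Rightarrow> real \<Rightarrow> real" where
  "quad_mean \<rho> x y z = (1 - \<rho>) * ((x + y + z) / 3)\<^sup>2 + \<rho> * ((x\<^sup>2 + y\<^sup>2 + z\<^sup>2) / 3)"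

text \<open>The absolute values make this differentiable across 0 for \<open>p > 1\<close>, so that a maximizer on a
  coordinate plane is a critical point as well.\<close>

definition pow_mean :: "real \<Rightarrow> real \<Rightarrow> real \<Rightarrow> real \<Rightarrow> real" where
  "pow_mean p x y z = ((\<bar>x\<bar> powr p + \<bar>y\<bar> powr p + \<bar>z\<bar> powr p) / 3) powr (2 / p)"

text \<open>Since \<open>1/p + 1/p* = 1\<close>, this is the constant of the theorem expressed through \<open>p\<close>
  instead of \<open>p*\<close>.\<close>

definition crit_sq :: "real \<Rightarrow> real" where
  "crit_sq p = (4 - 4 powr (1/p)) / (2 * (4 powr (1/p) - 1))"

lemma crit_sq_bounds:
  assumes "1 < p" "p < 2"
  shows "0 < crit_sq p" "crit_sq p < 1" "2 < 4 powr (1/p)" "4 powr (1/p) < 4"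
proof -
  have "(4::real) powr (1/2) < 4 powr (1/p)" "(4::real) powr (1/p) < 4 powr 1"
    using assms by (intro powr_less_mono; simp add: field_simps)+
  moreover have "(4::real) powr (1/2) = 2" by (simp add: powr_half_sqrt)
  ultimately show c: "2 < 4 powr (1/p)" "4 powr (1/p) < 4" by simp_all
  then show "0 < crit_sq p" "crit_sq p < 1" by (simp_all add: crit_sq_def field_simps)
qed

lemma quad_mean_scale: "quad_mean \<rho> (k * x) (k * y) (k * z) = k\<^sup>2 * quad_mean \<rho> x y z"
  by (simp add: quad_mean_def power2_eq_square field_simps)

lemma pow_mean_scale:
  assumes "0 < p"
  shows "pow_mean p (k * x) (k * y) (k * z) = k\<^sup>2 * pow_mean p x y z"
proof (cases "k = 0")
  case False
  have "pow_mean p (k * x) (k * y) (k * z)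
      = (\<bar>k\<bar> powr p * ((\<bar>x\<bar> powr p + \<bar>y\<bar> powr p + \<bar>z\<bar> powr p) / 3)) powr (2 / p)"
    by (simp add: pow_mean_def abs_mult powr_mult algebra_simps)
  also have "\<dots> = (\<bar>k\<bar> powr p) powr (2 / p) * pow_mean p x y z"
    unfolding pow_mean_def by (rule powr_mult)
  also have "(\<bar>k\<bar> powr p) powr (2 / p) = k\<^sup>2"
    using assms False by (simp add: powr_powr)
  finally show ?thesis .
qed (use assms in \<open>simp add: pow_mean_def\<close>)

text \<open>Identifies the left side of \<open>two_valued_powr\<close>, with \<open>x\<close> for
  \<open>t powr s\<close>, as a multiple of \<open>quad_mean\<close>.\<close>

lemma quad_mean_two_valued:
  assumes c: "c = 4 powr (1/p)" "c \<noteq> 1"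
  shows "quad_mean (crit_sq p) x 1 1 = (x\<^sup>2 + (2 * c - 4) * x + c) / (3 * (c - 1))"
proof -
  have "crit_sq p = (4 - c) / (2 * (c - 1))" by (simp add: crit_sq_def c)
  then have r: "crit_sq p * (2 * (c - 1)) = 4 - c" using c(2) by simp
  have "quad_mean (crit_sq p) x 1 1 * (18 * (c - 1))
      = 2 * (c - 1) * (x + 2)\<^sup>2 + crit_sq p * (2 * (c - 1)) * (2 * (x - 1)\<^sup>2)"
    by (simp add: quad_mean_def power2_eq_square field_simps)
  also have "\<dots> = 6 * (x\<^sup>2 + (2 * c - 4) * x + c)"
    unfolding r by (simp add: power2_eq_square algebra_simps)
  finally show ?thesis using c(2) by (simp add: field_simps)
qed

text \<open>By homogeneity only \<open>u = x / y\<close> matters, and \<open>two_valued_powr\<close>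
  applies with \<open>s = 1/p\<close> and \<open>t = u powr p\<close>.\<close>

lemma two_valued:
  assumes p: "1 < p" "p < 2" and xy: "0 < x" "0 < y"
  shows "quad_mean (crit_sq p) x y y \<le> pow_mean p x y y"
proof -
  define c where "c = (4::real) powr (1/p)"
  define u where "u = x / y"
  have u: "0 < u" using xy by (simp add: u_def)
  have c: "2 < c" using crit_sq_bounds[OF p] by (simp add: c_def)
  have "((u powr p) powr (1/p))\<^sup>2 + (2 * c - 4) * (u powr p) powr (1/p) + c
      \<le> 3 * (c - 1) * ((u powr p + 2) / 3) powr (2 * (1/p))"
    unfolding c_def using p u by (intro two_valued_powr) (auto simp: field_simps)
  moreover have "(u powr p) powr (1/p) = u" using p u by (simp add: powr_powr)
  ultimately have "quad_mean (crit_sq p) u 1 1 \<le> pow_mean p u 1 1"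
    using c u by (simp add: quad_mean_two_valued[OF c_def] pow_mean_def field_simps)
  then have "y\<^sup>2 * quad_mean (crit_sq p) u 1 1 \<le> y\<^sup>2 * pow_mean p u 1 1"
    by (rule mult_left_mono) simp
  moreover have "x = y * u" using xy by (simp add: u_def)
  ultimately show ?thesis
    using quad_mean_scale[of "crit_sq p" y u 1 1] pow_mean_scale[of p y u 1 1] p by simp
qed

section \<open>Critical points of the quotient\<close>

text \<open>At 0 the difference quotient has modulus \<open>\<bar>t\<bar> powr (p - 1)\<close>,
  which tends to 0 because \<open>1 < p\<close>.\<close>

lemma DERIV_abs_powr:
  fixes p x :: real
  assumes "1 < p" "0 \<le> x"
  shows "((\<lambda>t. \<bar>t\<bar> powr p) has_real_derivative p * x powr (p - 1)) (at x)"
proof (cases "x = 0")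
  case True
  have "((\<lambda>t. \<bar>t\<bar> powr (p - 1)) \<longlongrightarrow> 0) (at 0)"
    using assms by (intro tendsto_zero_powrI[where b = "p - 1"] tendsto_rabs_zero) auto
  moreover have "\<bar>t\<bar> powr (p - 1) = \<bar>\<bar>t\<bar> powr p / t\<bar>" for t :: real
    by (cases "t = 0") (simp_all add: powr_diff abs_divide)
  ultimately have "((\<lambda>t. \<bar>\<bar>t\<bar> powr p / t\<bar>) \<longlongrightarrow> 0) (at 0)" by simp
  then have "((\<lambda>t. \<bar>t\<bar> powr p / t) \<longlongrightarrow> 0) (at 0)"
    by (rule tendsto_rabs_zero_cancel)
  then show ?thesis using True by (simp add: DERIV_def)
next
  case False
  then have x: "0 < x" using assms by simp
  have "((\<lambda>t. t powr p) has_real_derivative p * x powr (p - 1)) (at x)"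
    by (rule has_real_derivative_powr[OF x])
  moreover have "\<bar>t\<bar> powr p = t powr p" for t :: real
    by (simp add: abs_if uminus_powr_eq)
  ultimately show ?thesis by simp
qed

text \<open>In the first coordinate, \<open>quad_mean - M * pow_mean\<close> has its maximum 0 at
  \<open>x\<close>. The bound covers negative \<open>t\<close> too, so the derivative vanishes even
  when \<open>x = 0\<close>.\<close>

lemma critical_point:
  fixes x y z :: real
  assumes p: "1 < p" and x: "0 \<le> x" and pos: "0 < \<bar>x\<bar> powr p + \<bar>y\<bar> powr p + \<bar>z\<bar> powr p"
    and le: "\<And>t. quad_mean \<rho> t y z \<le> M * pow_mean p t y z"
    and eq: "quad_mean \<rho> x y z = M * pow_mean p x y z"
  shows "(1 - \<rho>) * ((x + y + z) / 3) + \<rho> * x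
    = M * ((\<bar>x\<bar> powr p + \<bar>y\<bar> powr p + \<bar>z\<bar> powr p) / 3) powr (2 / p - 1) * x powr (p - 1)"
proof -
  define S where "S = (\<bar>x\<bar> powr p + \<bar>y\<bar> powr p + \<bar>z\<bar> powr p) / 3"
  have S: "0 < S" using pos by (simp add: S_def)
  let ?D = "2/3 * ((1 - \<rho>) * ((x + y + z) / 3) + \<rho> * x - M * S powr (2 / p - 1) * x powr (p - 1))"
  have "((\<lambda>t. (\<bar>t\<bar> powr p + \<bar>y\<bar> powr p + \<bar>z\<bar> powr p) / 3)
      has_real_derivative p * x powr (p - 1) / 3) (at x)"
    using DERIV_cdivide[OF DERIV_add[OF DERIV_add[OF DERIV_abs_powr[OF p x] DERIV_const] DERIV_const]]
    by simp
  from has_real_derivative_powr[THEN DERIV_chain2, OF _ this, of "2 / p"]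
  have "((\<lambda>t. pow_mean p t y z) has_real_derivative
      2 / p * S powr (2 / p - 1) * (p * x powr (p - 1) / 3)) (at x)"
    unfolding pow_mean_def S_def[symmetric] using S by blast
  then have "((\<lambda>t. quad_mean \<rho> t y z - M * pow_mean p t y z) has_real_derivative ?D) (at x)"
    unfolding quad_mean_def using p
    by (auto intro!: derivative_eq_intros simp: field_simps)
  then have "?D = 0"
    by (rule DERIV_local_max[where d = 1]) (use le eq in auto)
  then show ?thesis unfolding S_def by simp
qed

text \<open>Rolle's theorem on both gaps gives two zeros of the derivative of \<open>\<psi>\<close>,
  but \<open>t powr (a - 1)\<close> is strictly decreasing.\<close>

lemma affine_powr_three_points:
  fixes x y z :: real
  assumes a: "0 < a" "a < 1" and l: "l \<noteq> 0" and xyz: "0 < x" "x < y" "y < z"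
    and x: "m + \<rho> * x = l * x powr a"
    and y: "m + \<rho> * y = l * y powr a"
    and z: "m + \<rho> * z = l * z powr a"
  shows False
proof -
  define \<psi> where "\<psi> t = m + \<rho> * t - l * t powr a" for t
  have d: "(\<psi> has_real_derivative \<rho> - l * (a * t powr (a - 1))) (at t)" if "0 < t" for t
    unfolding \<psi>_def using that by (auto intro!: derivative_eq_intros)
  have root: "\<exists>w>u. w < v \<and> \<rho> - l * (a * w powr (a - 1)) = 0"
    if "0 < u" "u < v" "\<psi> u = \<psi> v" for u v
  proof -
    have cont: "continuous_on {u..v} \<psi>"
      using d that by (intro DERIV_continuous_on[where D = "\<lambda>t. \<rho> - l * (a * t powr (a - 1))"])
        (auto intro: has_field_derivative_at_within)
    have "\<exists>w>u. w < v \<and> DERIV \<psi> w :> 0"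
      by (rule Rolle[OF that(2,3) cont]) (meson d less_trans real_differentiable_def that(1))
    then show ?thesis using d that DERIV_unique by (meson less_trans)
  qed
  obtain w1 where w1: "x < w1" "w1 < y" "\<rho> = l * (a * w1 powr (a - 1))"
    using root[of x y] xyz x y by (auto simp: \<psi>_def)
  obtain w2 where w2: "y < w2" "w2 < z" "\<rho> = l * (a * w2 powr (a - 1))"
    using root[of y z] xyz y z by (auto simp: \<psi>_def)
  have "w1 powr (a - 1) = w2 powr (a - 1)" using w1(3) w2(3) a l by simp
  moreover have "w2 powr (a - 1) < w1 powr (a - 1)"
    using a w1 w2 xyz by (intro powr_less_mono2_neg) auto
  ultimately show False by simp
qed

lemma quad_mean_abs:
  assumes "\<rho> \<le> 1"
  shows "quad_mean \<rho> x y z \<le> quad_mean \<rho> \<bar>x\<bar> \<bar>y\<bar> \<bar>z\<bar>"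
proof -
  have "\<bar>x + y + z\<bar> \<le> \<bar>x\<bar> + \<bar>y\<bar> + \<bar>z\<bar>" by linarith
  from power_mono[OF this, of 2]
  have "((x + y + z) / 3)\<^sup>2 \<le> ((\<bar>x\<bar> + \<bar>y\<bar> + \<bar>z\<bar>) / 3)\<^sup>2"
    by (simp add: power_divide)
  then have "(1 - \<rho>) * ((x + y + z) / 3)\<^sup>2 \<le> (1 - \<rho>) * ((\<bar>x\<bar> + \<bar>y\<bar> + \<bar>z\<bar>) / 3)\<^sup>2"
    using assms by (intro mult_left_mono) auto
  then show ?thesis by (simp add: quad_mean_def)
qed

lemma quad_mean_perm:
  "quad_mean \<rho> y x z = quad_mean \<rho> x y z" "quad_mean \<rho> z y x = quad_mean \<rho> x y z"
  by (simp_all add: quad_mean_def add_ac)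

lemma pow_mean_perm:
  "pow_mean p y x z = pow_mean p x y z" "pow_mean p z y x = pow_mean p x y z"
  by (simp_all add: pow_mean_def add_ac)

lemma pow_mean_pos:
  assumes "(x, y, z) \<noteq> (0, 0, 0)"
  shows "0 < \<bar>x\<bar> powr p + \<bar>y\<bar> powr p + \<bar>z\<bar> powr p" "0 < pow_mean p x y z"
proof -
  have "0 \<le> \<bar>x\<bar> powr p" "0 \<le> \<bar>y\<bar> powr p" "0 \<le> \<bar>z\<bar> powr p" by simp_all
  moreover have "0 < \<bar>x\<bar> powr p \<or> 0 < \<bar>y\<bar> powr p \<or> 0 < \<bar>z\<bar> powr p"
    using assms by auto
  ultimately show *: "0 < \<bar>x\<bar> powr p + \<bar>y\<bar> powr p + \<bar>z\<bar> powr p" by linarith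
  then show "0 < pow_mean p x y z" by (simp add: pow_mean_def)
qed

text \<open>Both sides are homogeneous of degree 2, so the best constant \<open>M\<close> is
  attained on the compact unit sphere. It remains to show \<open>M \<le> 1\<close>, which
  \<open>two_valued\<close> gives once two coordinates of a maximizer agree.\<close>

lemma quad_mean_le_pow_mean:
  assumes p: "1 < p" "p < 2"
  shows "quad_mean (crit_sq p) x y z \<le> pow_mean p x y z"
proof -
  define \<rho> where "\<rho> = crit_sq p"
  have \<rho>: "0 < \<rho>" "\<rho> < 1" using crit_sq_bounds[OF p] by (simp_all add: \<rho>_def)
  let ?S = "sphere (0 :: real \<times> real \<times> real) 1"
  define q where "q v = quad_mean \<rho> (fst v) (fst (snd v)) (snd (snd v))" for v
  define w where "w v = pow_mean p (fst v) (fst (snd v)) (snd (snd v))" for v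
  have w_pos: "0 < w v" if "v \<noteq> 0" for v
    unfolding w_def using that by (intro pow_mean_pos(2)) (auto simp: prod_eq_iff zero_prod_def)
  have "continuous_on ?S q"
    unfolding q_def quad_mean_def by (intro continuous_intros) auto
  moreover have "continuous_on ?S w"
    unfolding w_def pow_mean_def using p
    by (intro continuous_on_powr' continuous_intros) auto
  moreover have "\<forall>v\<in>?S. w v \<noteq> 0"
  proof
    fix v assume "v \<in> ?S"
    then have "v \<noteq> 0" by auto
    then show "w v \<noteq> 0" using w_pos[of v] by simp
  qed
  ultimately have cont: "continuous_on ?S (\<lambda>v. q v / w v)"
    by (rule continuous_on_divide)
  have "(1, 0, 0) \<in> ?S" by (simp add: norm_Pair)
  then have "?S \<noteq> {}" by blast
  from continuous_attains_sup[OF compact_sphere this cont]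
  obtain v0 where v0: "v0 \<in> ?S" and max: "\<And>v. v \<in> ?S \<Longrightarrow> q v / w v \<le> q v0 / w v0"
    by blast
  define M where "M = q v0 / w v0"
  have v0_nz: "v0 \<noteq> 0" using v0 by auto
  have le: "quad_mean \<rho> x y z \<le> M * pow_mean p x y z" for x y z
  proof (cases "(x, y, z) = 0")
    case True
    then show ?thesis using p by (simp add: zero_prod_def quad_mean_def pow_mean_def)
  next
    case False
    define k where "k = 1 / norm (x, y, z)"
    have k: "k \<noteq> 0" using False by (simp add: k_def)
    define u where "u = (k * x, k * y, k * z)"
    have u_eq: "u = k *\<^sub>R (x, y, z)" by (simp add: u_def)
    have "norm u = 1" unfolding u_eq norm_scaleR using False by (simp add: k_def)
    then have u: "u \<in> ?S" by simp
    have "u \<noteq> 0" using u by auto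
    then have "q u \<le> M * w u" using max[OF u] w_pos[of u] by (simp add: M_def pos_divide_le_eq)
    then have "k\<^sup>2 * quad_mean \<rho> x y z \<le> k\<^sup>2 * (M * pow_mean p x y z)"
      using p by (simp add: q_def w_def u_def quad_mean_scale pow_mean_scale mult.left_commute)
    then show ?thesis using k by simp
  qed
  obtain a b c where abc: "v0 = (a, b, c)" by (cases v0)
  define x0 y0 z0 where "x0 = \<bar>a\<bar>" and "y0 = \<bar>b\<bar>" and "z0 = \<bar>c\<bar>"
  have nonneg: "0 \<le> x0" "0 \<le> y0" "0 \<le> z0" by (simp_all add: x0_def y0_def z0_def)
  have nz: "(x0, y0, z0) \<noteq> (0, 0, 0)"
    using v0_nz unfolding abc x0_def y0_def z0_def zero_prod_def by simp
  note pos = pow_mean_pos[OF nz, of p]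
  \<comment> \<open>Absolute values preserve \<open>pow_mean\<close> and do not decrease
    \<open>quad_mean\<close>, so they turn the maximizer into a nonnegative one.\<close>
  have eq: "quad_mean \<rho> x0 y0 z0 = M * pow_mean p x0 y0 z0"
  proof (rule antisym[OF le])
    have "M * pow_mean p x0 y0 z0 = M * w v0"
      by (simp add: abc w_def pow_mean_def x0_def y0_def z0_def)
    also have "\<dots> = q v0" using w_pos[OF v0_nz] by (simp add: M_def)
    also have "\<dots> \<le> quad_mean \<rho> x0 y0 z0"
      unfolding q_def abc x0_def y0_def z0_def using quad_mean_abs[of \<rho> a b c] \<rho> by simp
    finally show "M * pow_mean p x0 y0 z0 \<le> quad_mean \<rho> x0 y0 z0" .
  qed
  define m where "m = (1 - \<rho>) * ((x0 + y0 + z0) / 3)"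
  define l where "l = M * ((\<bar>x0\<bar> powr p + \<bar>y0\<bar> powr p + \<bar>z0\<bar> powr p) / 3) powr (2 / p - 1)"
  have sum_pos: "0 < x0 + y0 + z0" using nonneg nz by auto
  have "0 < m" using sum_pos \<rho> by (simp add: m_def)
  \<comment> \<open>The symmetry of both means carries \<open>critical_point\<close> over to the
    other two coordinates, with the same \<open>m\<close> and \<open>l\<close>.\<close>
  have crit: "m + \<rho> * t = l * t powr (p - 1)" if "t \<in> {x0, y0, z0}" for t
  proof -
    have "m + \<rho> * x0 = l * x0 powr (p - 1)"
      unfolding m_def l_def
      by (rule critical_point[OF p(1) nonneg(1) pos(1) le eq])
    moreover have "m + \<rho> * y0 = l * y0 powr (p - 1)"
      using critical_point[OF p(1) nonneg(2), where y = x0 and z = z0 and \<rho> = \<rho> and M = M]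
        pos(1) le eq unfolding m_def l_def by (simp add: quad_mean_perm pow_mean_perm add_ac)
    moreover have "m + \<rho> * z0 = l * z0 powr (p - 1)"
      using critical_point[OF p(1) nonneg(3), where y = y0 and z = x0 and \<rho> = \<rho> and M = M]
        pos(1) le eq unfolding m_def l_def
      by (simp add: quad_mean_perm(2)[of \<rho> z0 y0 x0] pow_mean_perm(2)[of p z0 y0 x0] add_ac)
    ultimately show ?thesis using that by auto
  qed
  \<comment> \<open>At \<open>t = 0\<close> the critical equation would read
    \<open>m = 0\<close>.\<close>
  have t_pos: "0 < t" if "t \<in> {x0, y0, z0}" for t
  proof (rule ccontr)
    assume "\<not> 0 < t"
    then have "t = 0" using that nonneg by auto
    then show False using crit[OF that] \<open>0 < m\<close> by simp
  qed
  have "l \<noteq> 0"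
  proof
    assume "l = 0"
    then have "m + \<rho> * x0 = 0" using crit[of x0] by simp
    then show False using \<open>0 < m\<close> \<rho> nonneg(1) by (smt (verit) mult_nonneg_nonneg)
  qed
  have no_triple: False if "t1 < t2" "t2 < t3" "{t1, t2, t3} \<subseteq> {x0, y0, z0}" for t1 t2 t3
    by (rule affine_powr_three_points[of "p - 1" l t1 t2 t3 m \<rho>])
      (use that p \<open>l \<noteq> 0\<close> in \<open>auto intro!: crit t_pos\<close>)
  have "x0 = y0 \<or> y0 = z0 \<or> x0 = z0"
  proof (rule ccontr)
    assume "\<not> ?thesis"
    then consider "x0 < y0 \<and> y0 < z0" | "x0 < z0 \<and> z0 < y0" | "y0 < x0 \<and> x0 < z0"
      | "y0 < z0 \<and> z0 < x0" | "z0 < x0 \<and> x0 < y0" | "z0 < y0 \<and> y0 < x0"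
      by linarith
    then show False
      using no_triple[of x0 y0 z0] no_triple[of x0 z0 y0] no_triple[of y0 x0 z0]
        no_triple[of y0 z0 x0] no_triple[of z0 x0 y0] no_triple[of z0 y0 x0]
      by cases auto
  qed
  then have "quad_mean \<rho> x0 y0 z0 \<le> pow_mean p x0 y0 z0"
  proof (elim disjE)
    assume "x0 = y0"
    then show ?thesis
      using two_valued[OF p, of z0 y0] t_pos quad_mean_perm(2)[of \<rho> z0 y0 y0]
        pow_mean_perm(2)[of p z0 y0 y0] by (simp add: \<rho>_def)
  next
    assume "y0 = z0"
    then show ?thesis using two_valued[OF p, of x0 y0] t_pos by (simp add: \<rho>_def)
  next
    assume "x0 = z0"
    then show ?thesis
      using two_valued[OF p, of y0 z0] t_pos quad_mean_perm(1)[of \<rho> y0 z0 z0]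
        pow_mean_perm(1)[of p y0 z0 z0] by (simp add: \<rho>_def)
  qed
  then have "M \<le> 1" using eq pos(2) by simp
  moreover have "0 \<le> pow_mean p x y z" by (simp add: pow_mean_def)
  ultimately have "M * pow_mean p x y z \<le> 1 * pow_mean p x y z" by (rule mult_right_mono)
  then show ?thesis using le[of x y z] by (simp add: \<rho>_def)
qed

section \<open>Operator norms\<close>

definition mean :: "(3 \<Rightarrow> complex) \<Rightarrow> complex" where
  "mean f = (f 0 + f 1 + f 2) / 3"

definition ip :: "(3 \<Rightarrow> complex) \<Rightarrow> (3 \<Rightarrow> complex) \<Rightarrow> complex" where
  "ip f g = (\<Sum>k\<in>UNIV. f k * cnj (g k)) / 3"

text \<open>The coefficient \<open>a0\<close> is the mean, and \<open>T r\<close> scales the rest by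
  \<open>r\<close>; this removes the characters from all later computations.\<close>

lemma T_apply: "T r f k = (1 - of_real r) * mean f + of_real r * f k"
proof -
  obtain a0 a1 a2 where f: "f = trig a0 a1 a2" using trig_exists by blast
  have "a0 = mean f" unfolding mean_def f trig_coeffs(1)[of a0 a1 a2, symmetric] by simp
  moreover have "T r f k = (1 - of_real r) * a0 + of_real r * f k"
    by (simp add: f T_trig) (simp add: trig_def algebra_simps)
  ultimately show ?thesis by simp
qed

lemma T_T: "T r (T s f) = T (r * s) f"
proof -
  obtain a0 a1 a2 where "f = trig a0 a1 a2" using trig_exists by blast
  then show ?thesis by (simp add: T_trig mult.assoc)
qed

lemma ip_T_left: "ip (T r f) g = (1 - of_real r) * (mean f * cnj (mean g)) + of_real r * ip f g"
  unfolding ip_def sum_Z3 T_apply by (simp add: mean_def field_simps)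

lemma ip_T_right: "ip f (T r g) = (1 - of_real r) * (mean f * cnj (mean g)) + of_real r * ip f g"
  unfolding ip_def sum_Z3 T_apply by (simp add: mean_def field_simps)

lemma T_self_adjoint: "ip (T r f) g = ip f (T r g)"
  by (simp add: ip_T_left ip_T_right)

lemma Lp_norm_nonneg [simp]: "0 \<le> Lp_norm p f"
  by (simp add: Lp_norm_def)

lemma Lp_norm_powr:
  assumes "0 < p"
  shows "Lp_norm p f powr p = (1/3) * (\<Sum>k\<in>UNIV. norm (f k) powr p)"
  using assms by (simp add: Lp_norm_def powr_powr sum_nonneg)

lemma Lp_norm_eq_0:
  assumes "0 < p" "Lp_norm p f = 0"
  shows "f k = 0"
proof -
  have "(\<Sum>k\<in>UNIV. norm (f k) powr p) = 0" using Lp_norm_powr[OF assms(1), of f] assms by simp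
  then show ?thesis by (simp add: sum_nonneg_eq_0_iff)
qed

lemma Lp_norm_square: "(Lp_norm p f)\<^sup>2 = pow_mean p (norm (f 0)) (norm (f 1)) (norm (f 2))"
  by (simp add: Lp_norm_def pow_mean_def sum_Z3 power2_eq_square flip: powr_add)

lemma Lp_norm_2_square: "(Lp_norm 2 f)\<^sup>2 = ((norm (f 0))\<^sup>2 + (norm (f 1))\<^sup>2 + (norm (f 2))\<^sup>2) / 3"
  by (simp add: Lp_norm_square pow_mean_def)

lemma ip_self: "ip f f = of_real ((Lp_norm 2 f)\<^sup>2)"
  by (simp add: Lp_norm_2_square ip_def sum_Z3 flip: complex_norm_square)

section \<open>Duality of the bounds\<close>

text \<open>Young's inequality at each point, after both functions are normalized to norm 1.\<close>

lemma Hoelder: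
  assumes pq: "1 < p" "1 < q" "1/p + 1/q = 1"
  shows "norm (ip f g) \<le> Lp_norm p f * Lp_norm q g"
proof (cases "Lp_norm p f = 0 \<or> Lp_norm q g = 0")
  case True
  then have "f k * cnj (g k) = 0" for k
    using Lp_norm_eq_0[of p f k] Lp_norm_eq_0[of q g k] pq by auto
  then have "ip f g = 0" by (simp only: ip_def sum.neutral_const div_0)
  then show ?thesis by simp
next
  case False
  define F where "F = Lp_norm p f"
  define G where "G = Lp_norm q g"
  have FG: "0 < F" "0 < G" using False by (auto simp: F_def G_def less_le)
  have unit: "(\<Sum>k\<in>UNIV. (norm (f k) / Lp_norm p f) powr p) = 3"
    if "0 < p" "0 < Lp_norm p f" for p f
  proof -
    have "(\<Sum>k\<in>UNIV. norm (f k) powr p) = 3 * Lp_norm p f powr p"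
      using that by (simp add: Lp_norm_powr)
    then show ?thesis using that by (simp add: powr_divide flip: sum_divide_distrib)
  qed
  have "norm (ip f g) \<le> (\<Sum>k\<in>UNIV. norm (f k) * norm (g k)) / 3"
    unfolding ip_def using norm_sum[of "\<lambda>k. f k * cnj (g k)" UNIV]
    by (simp add: norm_divide norm_mult)
  also have "\<dots> = F * G * ((\<Sum>k\<in>UNIV. norm (f k) / F * (norm (g k) / G)) / 3)"
    using FG by (simp flip: sum_divide_distrib)
  also have "\<dots> \<le> F * G * ((\<Sum>k\<in>UNIV. (norm (f k) / F) powr p / p + (norm (g k) / G) powr q / q) / 3)"
    using FG pq by (intro mult_left_mono divide_right_mono sum_mono Youngs_inequality) auto
  also have "\<dots> = F * G * (1/p + 1/q)"
    using unit[of p f] unit[of q g] pq FG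
    by (simp add: sum.distrib F_def G_def add_divide_distrib flip: sum_divide_distrib)
  finally show ?thesis using pq by (simp add: F_def G_def)
qed

text \<open>The test function is \<open>h = |g|\<^sup>q\<^sup>-\<^sup>2 g\<close> with \<open>g = T r f\<close>, the equality case of
  Hoelder's inequality for \<open>g\<close>.\<close>

lemma T_bound_dual:
  assumes pq: "1 < p" "1 < q" "1/p + 1/q = 1" and ab: "1 < a" "1 < b" "1/a + 1/b = 1"
    and bound: "\<And>f. Lp_norm a (T r f) \<le> Lp_norm p f"
  shows "Lp_norm q (T r f) \<le> Lp_norm b f"
proof (cases "Lp_norm q (T r f) = 0")
  case False
  define g where "g = T r f"
  define G where "G = Lp_norm q g"
  have G: "0 < G" using False by (simp add: G_def g_def less_le)
  have qp: "(q - 1) * p = q" "q / p = q - 1" using pq by (simp_all add: field_simps)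
  \<comment> \<open>Where \<open>g\<close> vanishes, so does \<open>h\<close>, and
    \<open>0 powr (q - 1)\<close> and \<open>0 powr q\<close> are 0 as well, so the formulas below
    need no case distinction.\<close>
  define h where "h k = of_real (norm (g k) powr (q - 2)) * g k" for k
  have norm_h: "norm (h k) = norm (g k) powr (q - 1)" for k
    using powr_mult_base[of "norm (g k)" "q - 2"] by (simp add: h_def norm_mult mult.commute)
  have gh: "g k * cnj (h k) = of_real (norm (g k) powr q)" for k
  proof -
    have "g k * cnj (h k) = of_real (norm (g k) powr (q - 2)) * (g k * cnj (g k))"
      by (simp add: h_def)
    also have "g k * cnj (g k) = of_real (norm (g k) * norm (g k))"
      by (simp add: complex_norm_square[symmetric] power2_eq_square[symmetric])
    also have "of_real (norm (g k) powr (q - 2)) * complex_of_real (norm (g k) * norm (g k))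
        = of_real (norm (g k) * (norm (g k) * norm (g k) powr (q - 2)))"
      by simp
    also have "norm (g k) * (norm (g k) * norm (g k) powr (q - 2)) = norm (g k) powr q"
      by (simp add: powr_mult_base)
    finally show ?thesis .
  qed
  have Gq: "G powr q = (1/3) * (\<Sum>k\<in>UNIV. norm (g k) powr q)"
    unfolding G_def using pq by (intro Lp_norm_powr) simp
  have "ip g h = of_real (G powr q)"
    unfolding ip_def gh Gq by simp
  then have "G powr q = norm (ip g h)" by simp
  also have "\<dots> = norm (ip f (T r h))" by (simp add: g_def T_self_adjoint)
  also have "\<dots> \<le> Lp_norm b f * Lp_norm a (T r h)"
    by (rule Hoelder) (use ab in auto)
  also have "\<dots> \<le> Lp_norm b f * Lp_norm p h"
    by (intro mult_left_mono bound) simp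
  \<comment> \<open>By \<open>(q - 1) * p = q\<close>, the functions
    \<open>norm (h k) powr p\<close> and \<open>norm (g k) powr q\<close> coincide.\<close>
  also have "Lp_norm p h = G powr (q - 1)"
    unfolding Lp_norm_def norm_h powr_powr qp(1) Gq[symmetric] using qp(2) by simp
  finally have "G * G powr (q - 1) \<le> Lp_norm b f * G powr (q - 1)"
    using G by (simp add: powr_mult_base)
  then show ?thesis using G by (simp add: G_def g_def)
qed simp

section \<open>The bound from exponent p to 2\<close>

text \<open>By self-adjointness and \<open>T_T\<close>, the left side is
  \<open>ip f (T (r * r) f)\<close>, whence the square of \<open>r\<close>.\<close>

lemma Lp_norm_2_T: "(Lp_norm 2 (T r f))\<^sup>2 = (1 - r\<^sup>2) * (norm (mean f))\<^sup>2 + r\<^sup>2 * (Lp_norm 2 f)\<^sup>2"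
proof -
  have "complex_of_real ((Lp_norm 2 (T r f))\<^sup>2) = ip f (T (r * r) f)"
    unfolding ip_self[symmetric] T_self_adjoint T_T ..
  also have "\<dots> = of_real ((1 - r\<^sup>2) * (norm (mean f))\<^sup>2 + r\<^sup>2 * (Lp_norm 2 f)\<^sup>2)"
    unfolding ip_T_right ip_self complex_norm_square[symmetric] by (simp add: power2_eq_square)
  finally show ?thesis by (simp only: of_real_eq_iff)
qed

text \<open>Passing to moduli can only enlarge the modulus of the mean. The coefficient of
  \<open>r\<^sup>2\<close> is then the variance of the moduli, so raising \<open>r\<^sup>2\<close>
  to \<open>\<rho>\<close> increases the bound.\<close>

lemma Lp_norm_2_T_le:
  assumes "r\<^sup>2 \<le> \<rho>" "\<rho> \<le> 1"
  shows "(Lp_norm 2 (T r f))\<^sup>2 \<le> quad_mean \<rho> (norm (f 0)) (norm (f 1)) (norm (f 2))"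
proof -
  let ?A = "(norm (f 0) + norm (f 1) + norm (f 2)) / 3"
  let ?E = "((norm (f 0))\<^sup>2 + (norm (f 1))\<^sup>2 + (norm (f 2))\<^sup>2) / 3"
  have "norm (mean f) \<le> ?A"
    unfolding mean_def norm_divide
    using norm_triangle_ineq[of "f 0 + f 1" "f 2"] norm_triangle_ineq[of "f 0" "f 1"] by simp
  then have m: "(norm (mean f))\<^sup>2 \<le> ?A\<^sup>2" by (intro power_mono) auto
  have "?E - ?A\<^sup>2 = ((norm (f 0) - norm (f 1))\<^sup>2 + (norm (f 1) - norm (f 2))\<^sup>2
      + (norm (f 0) - norm (f 2))\<^sup>2) / 9"
    by (simp add: power2_eq_square field_simps)
  also have "0 \<le> \<dots>" by simp
  finally have E: "?A\<^sup>2 \<le> ?E" by simp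
  have "(Lp_norm 2 (T r f))\<^sup>2 \<le> (1 - r\<^sup>2) * ?A\<^sup>2 + r\<^sup>2 * ?E"
    unfolding Lp_norm_2_T Lp_norm_2_square[of f] using m assms by (intro add_right_mono mult_left_mono) auto
  also have "\<dots> = ?A\<^sup>2 + r\<^sup>2 * (?E - ?A\<^sup>2)" by (simp add: algebra_simps)
  also have "\<dots> \<le> ?A\<^sup>2 + \<rho> * (?E - ?A\<^sup>2)"
    using E assms by (intro add_left_mono mult_right_mono) auto
  also have "\<dots> = quad_mean \<rho> (norm (f 0)) (norm (f 1)) (norm (f 2))"
    by (simp add: quad_mean_def algebra_simps)
  finally show ?thesis .
qed

lemma T_bound_p_2:
  assumes p: "1 < p" "p < 2" and r: "r\<^sup>2 \<le> crit_sq p"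
  shows "Lp_norm 2 (T r f) \<le> Lp_norm p f"
proof -
  have "(Lp_norm 2 (T r f))\<^sup>2 \<le> (Lp_norm p f)\<^sup>2"
    unfolding Lp_norm_square[of p]
    using Lp_norm_2_T_le[OF r] crit_sq_bounds[OF p] quad_mean_le_pow_mean[OF p]
    by (meson less_imp_le order_trans)
  then show ?thesis by (rule power2_le_imp_le) simp
qed

lemma T_bound_p_2_sharp:
  assumes p: "1 < p" "p < 2" and bound: "\<And>f. Lp_norm 2 (T r f) \<le> Lp_norm p f"
  shows "r\<^sup>2 \<le> crit_sq p"
proof -
  define c where "c = (4::real) powr (1/p)"
  have c: "2 < c" using crit_sq_bounds[OF p] by (simp add: c_def)
  \<comment> \<open>\<open>|f|\<^sup>p = (4, 1, 1)\<close> is the nonconstant equality case of \<open>two_valued_powr\<close>.\<close>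
  define f :: "3 \<Rightarrow> complex" where "f k = (if k = 0 then of_real c else 1)" for k
  have f: "f 0 = of_real c" "f 1 = 1" "f 2 = 1" by (simp_all add: f_def)
  have "mean f = of_real ((c + 2) / 3)" by (simp add: mean_def f)
  then have m: "(norm (mean f))\<^sup>2 = ((c + 2) / 3)\<^sup>2" by (simp only: norm_of_real power2_abs)
  have cp: "c powr p = 4" using p by (simp add: c_def powr_powr)
  \<comment> \<open>The mean of 4, 1, 1 is 2.\<close>
  have "(Lp_norm p f)\<^sup>2 = 2 powr (2 * (1/p))"
    using c cp by (simp add: Lp_norm_square pow_mean_def f)
  also have "\<dots> = c" by (subst powr_double) (simp_all add: c_def)
  finally have "(Lp_norm 2 (T r f))\<^sup>2 \<le> c"
    using power_mono[OF bound[of f], of 2] by simp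
  then have "(1 - r\<^sup>2) * ((c + 2) / 3)\<^sup>2 + r\<^sup>2 * ((c\<^sup>2 + 2) / 3) \<le> c"
    unfolding Lp_norm_2_T m by (simp add: Lp_norm_2_square[of f] f add.commute)
  \<comment> \<open>As a function of \<open>r\<^sup>2\<close>, the second factor has its zero
    exactly at \<open>crit_sq p\<close>.\<close>
  moreover have "(1 - r\<^sup>2) * ((c + 2) / 3)\<^sup>2 + r\<^sup>2 * ((c\<^sup>2 + 2) / 3) - c
      = (c - 1) * (2 * (c - 1) * r\<^sup>2 - (4 - c)) / 9"
    by (simp add: power2_eq_square field_simps)
  ultimately have "(c - 1) * (2 * (c - 1) * r\<^sup>2 - (4 - c)) \<le> 0" by simp
  then have "2 * (c - 1) * r\<^sup>2 \<le> 4 - c" using c by (simp add: mult_le_0_iff)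
  then show ?thesis unfolding crit_sq_def c_def[symmetric] using c by (simp add: field_simps)
qed

section \<open>The three constants\<close>

lemma r_const_eqI:
  assumes "admissible p q m" "\<And>s. admissible p q s \<Longrightarrow> s \<le> m"
  shows "r_const p q = m"
  unfolding r_const_def using assms by (rule Greatest_equality)

theorem corollary1p4:
  fixes p pstar :: real
  assumes "1 < p" and "p < 2" and "pstar = p / (p - 1)"
  shows "r_const p pstar = 2 * (4 powr (1/pstar) - 1) / (4 - 4 powr (1/pstar))
    \<and> r_const p 2 = r_const 2 pstar
    \<and> r_const 2 pstar = sqrt (2 * (4 powr (1/pstar) - 1) / (4 - 4 powr (1/pstar)))
    \<and> r_const p pstar = r_const p 2 * r_const 2 pstar"
proof -
  note p = assms(1,2)
  note \<rho> = crit_sq_bounds[OF p]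
  have pq: "1 < pstar" "1/p + 1/pstar = 1" using p by (simp_all add: assms(3) field_simps)
  have "1/pstar = 1 - 1/p" using pq(2) by linarith
  then have "(4::real) powr (1/pstar) = 4 powr (1 - 1/p)" by simp
  also have "\<dots> = 4 / 4 powr (1/p)" by (simp add: powr_diff)
  finally have e: "(4::real) powr (1/pstar) = 4 / 4 powr (1/p)" .
  have const: "2 * (4 powr (1/pstar) - 1) / (4 - 4 powr (1/pstar)) = crit_sq p"
    unfolding crit_sq_def e by (subst frac_eq_eq) (use p \<rho>(3,4) in \<open>simp_all add: field_simps\<close>)
  have dual: "Lp_norm pstar (T r f) \<le> Lp_norm 2 f" if "\<And>f. Lp_norm 2 (T r f) \<le> Lp_norm p f" for r f
    by (rule T_bound_dual[of p pstar 2 2]) (use p pq that in auto)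
  have dual': "Lp_norm 2 (T r f) \<le> Lp_norm p f" if "\<And>f. Lp_norm pstar (T r f) \<le> Lp_norm 2 f" for r f
    by (rule T_bound_dual[of 2 2 pstar p]) (use p pq that in auto)
  have p2: "r_const p 2 = sqrt (crit_sq p)"
  proof (rule r_const_eqI)
    have "r\<^sup>2 \<le> crit_sq p" if "r \<in> {0..sqrt (crit_sq p)}" for r
      using power_mono[of r "sqrt (crit_sq p)" 2] that \<rho> by simp
    then show "admissible p 2 (sqrt (crit_sq p))"
      using T_bound_p_2[OF p] \<rho> by (auto simp: admissible_def)
  next
    fix s assume "admissible p 2 s"
    then have "s\<^sup>2 \<le> crit_sq p" by (intro T_bound_p_2_sharp[OF p]) (auto simp: admissible_def)
    then show "s \<le> sqrt (crit_sq p)" by (rule real_le_rsqrt)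
  qed
  \<comment> \<open>Duality in both directions makes the two bounds equivalent for each
    \<open>r\<close>, so the admissible constants are the same.\<close>
  have "admissible 2 pstar s \<longleftrightarrow> admissible p 2 s" for s
    unfolding admissible_def using dual dual' by blast
  then have "r_const 2 pstar = r_const p 2" by (simp add: r_const_def)
  moreover have "r_const p pstar = crit_sq p"
  proof (rule r_const_eqI)
    \<comment> \<open>Factor \<open>T s\<close> as \<open>T (sqrt s)\<close> twice, passing from
      exponent \<open>p\<close> through 2 to \<open>pstar\<close>.\<close>
    have "Lp_norm pstar (T s f) \<le> Lp_norm p f" if s: "s \<in> {0..crit_sq p}" for s f
    proof -
      have b: "Lp_norm 2 (T (sqrt s) f) \<le> Lp_norm p f" for f
        by (rule T_bound_p_2[OF p]) (use s in simp)
      have "T s f = T (sqrt s) (T (sqrt s) f)" using s by (simp add: T_T)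
      then have "Lp_norm pstar (T s f) \<le> Lp_norm 2 (T (sqrt s) f)" using dual[OF b] by simp
      then show ?thesis using b order_trans by blast
    qed
    then show "admissible p pstar (crit_sq p)" using \<rho> by (auto simp: admissible_def)
  next
    fix s assume s: "admissible p pstar s"
    then have s0: "0 \<le> s" by (simp add: admissible_def)
    \<comment> \<open>The converse: the squared 2-norm equals \<open>ip f (T s f)\<close>, which
      Hoelder's inequality and the assumed bound for \<open>T s\<close> control.\<close>
    have "Lp_norm 2 (T (sqrt s) f) \<le> Lp_norm p f" for f
    proof -
      have "complex_of_real ((Lp_norm 2 (T (sqrt s) f))\<^sup>2) = ip f (T s f)"
        unfolding ip_self[symmetric] T_self_adjoint T_T using s0 by simp
      then have "(Lp_norm 2 (T (sqrt s) f))\<^sup>2 = norm (ip f (T s f))"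
        by (metis abs_power2 norm_of_real)
      also have "\<dots> \<le> Lp_norm p f * Lp_norm pstar (T s f)"
        by (rule Hoelder) (use p pq in auto)
      also have "\<dots> \<le> Lp_norm p f * Lp_norm p f"
        using s by (intro mult_left_mono) (auto simp: admissible_def)
      also have "\<dots> = (Lp_norm p f)\<^sup>2" by (simp add: power2_eq_square)
      finally show ?thesis by (rule power2_le_imp_le) simp
    qed
    then have "(sqrt s)\<^sup>2 \<le> crit_sq p" by (rule T_bound_p_2_sharp[OF p])
    then show "s \<le> crit_sq p" using s0 by simp
  qed
  ultimately show ?thesis unfolding const using p2 \<rho>(1) by simp
qed

end
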